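(* Let $n\geq 2$, let $D\subset\mathbb C$ be a bounded convex domain, and let $A\in M_n(\mathbb C)$ satisfy $\sigma(A)\subset D$. Suppose that $\mathcal M_D(A)>1$. Then for every $\gamma\geq 1$ there is a positive invertible matrix $S\in M_n(\mathbb C)$ with $\kappa(S)=\gamma$ such that $$\mathcal M_D(S^{-1}AS)=\gamma\,\mathcal M_D(A).$$ Consequently, for every $\gamma\geq 1$, $$\max_{\kappa(R)\leq\gamma}\mathcal M_D(R^{-1}AR)=\gamma\,\mathcal M_D(A),$$ where the maximum is over all invertible $R\in M_n(\mathbb C)$ with $\kappa(R)\leq\gamma$ (and is attained).
   Context: $M_n(\mathbb C)$ is the set of complex $n\times n$ matrices, with the operator norm induced by the Euclidean norm on $\mathbb C^n$; $\sigma(B)$ is the spectrum of $B$. A domain is a nonempty connected open subset of $\mathbb C$. For invertible $S$, $\kappa(S)=\|S\|\,\|S^{-1}\|$. Let $K\subset\mathbb C$ be compact with $\sigma(B)\subset K$ and let $C\geq 1$. $K$ is a $C$-spectral set for $B$ (and $C$ is a spectral constant for $B$ on $K$) if $\|f(B)\|\leq C\max_{z\in K}|f(z)|$ for every rational function $f$ with poles off $K$. The least such $C\geq 1$ is called the optimal spectral constant of $K$ for $B$. For a bounded convex domain $D$ and $B\in M_n(\mathbb C)$ with $\sigma(B)\subset D$, $\mathcal M_D(B)$ denotes the optimal spectral constant of $\overline D$ for $B$. Equivalently, $\mathcal M_D(B)=\sup\{\|f(B)\| : f\in\mathcal A(\overline D),\ \max_{\overline D}|f|\leq 1\}$, where $\mathcal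 A(\overline D)$ is the set of functions continuous on $\overline D$ and holomorphic in $D$, and $f(B)$ is defined by the holomorphic functional calculus. *)

theory Defs
  imports "HOL-Analysis.Analysis" "HOL-Computational_Algebra.Polynomial"
begin

text \<open>
  The norm on \<^typ>\<open>complex ^ 'n\<close> is the Euclidean one, so \<^const>\<open>onorm\<close> is the induced
  operator norm.
\<close>

definition opnorm :: "complex ^ 'n ^ 'n \<Rightarrow> real" where
  "opnorm B = onorm ((*v) B)"

definition spectrum :: "complex ^ 'n ^ 'n \<Rightarrow> complex set" where
  "spectrum B = {z. \<not> invertible (mat z - B)}"

definition condition_number :: "complex ^ 'n ^ 'n \<Rightarrow> real" where
  "condition_number S = opnorm S * opnorm (matrix_inv S)"

text \<open>
  Positivity in the operator sense: the Hermitian form \<open>\<langle>S x, x\<rangle>\<close> is real and nonnegative for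
  every \<open>x\<close>. Over the complex numbers this already forces \<open>S\<close> to be Hermitian.
\<close>

definition positive_matrix :: "complex ^ 'n ^ 'n \<Rightarrow> bool" where
  "positive_matrix S \<longleftrightarrow>
     (\<forall>x. (\<Sum>i\<in>UNIV. (S *v x) $ i * cnj (x $ i)) \<in> \<real>\<^sub>\<ge>\<^sub>0)"

text \<open>
  Multiplication and powers of \<^typ>\<open>complex ^ 'n ^ 'n\<close> as a ring type are entrywise, so matrix powers
  are iterated \<open>(**)\<close>.
\<close>

definition poly_matrix :: "complex poly \<Rightarrow> complex ^ 'n ^ 'n \<Rightarrow> complex ^ 'n ^ 'n" where
  "poly_matrix p B = (\<Sum>i\<le>degree p. mat (coeff p i) ** (((**) B ^^ i) (mat 1)))"

text \<open>
  \<open>f(B)\<close> for the rational function \<open>f = p / q\<close>; meaningful when \<open>q\<close> has no zero in the spectrum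
  of \<open>B\<close>, so that \<open>q(B)\<close> is invertible.
\<close>

definition rational_matrix ::
    "complex poly \<Rightarrow> complex poly \<Rightarrow> complex ^ 'n ^ 'n \<Rightarrow> complex ^ 'n ^ 'n" where
  "rational_matrix p q B = poly_matrix p B ** matrix_inv (poly_matrix q B)"

text \<open>
  The rational functions with poles off \<open>K\<close> are exactly the quotients \<open>p / q\<close> with \<open>q\<close> free of
  zeros on \<open>K\<close>. The set \<open>K\<close> is compact and nonempty (it contains the spectrum), so the
  supremum is a maximum.
\<close>

definition spectral_set :: "real \<Rightarrow> complex set \<Rightarrow> complex ^ 'n ^ 'n \<Rightarrow> bool" where
  "spectral_set C K B \<longleftrightarrow>
     compact K \<and> spectrum B \<subseteq> K \<and> 1 \<le> C \<and>
     (\<forall>p q. (\<forall>z\<in>K. poly q z \<noteq> 0) \<longrightarrow>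
        opnorm (rational_matrix p q B) \<le> C * (SUP z\<in>K. cmod (poly p z / poly q z)))"

definition optimal_spectral_constant :: "complex set \<Rightarrow> complex ^ 'n ^ 'n \<Rightarrow> real" where
  "optimal_spectral_constant K B = (LEAST C. spectral_set C K B)"

definition spectral_constant_on :: "complex set \<Rightarrow> complex ^ 'n ^ 'n \<Rightarrow> real" ("\<M>") where
  "\<M> D B = optimal_spectral_constant (closure D) B"

end

(*
  The upper bound is immediate from f(R^-1 A R) = R^-1 f(A) R.  For the lower bound let
  M = M_D(A) > 1, choose rational f_k bounded by 1 on the closure of D and unit vectors x_k with
  |f_k(A) x_k| -> M, and pass to limits x_k -> x, f_k(A) x_k -> u, so |x| = 1 and |u| = M.
  Composing f_k with disc automorphisms gives |u + a x| <= M |x + cnj a u| for |a| < 1, and the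
  first-order terms in a force u to be orthogonal to x because M > 1.  Hence the positive matrix S
  that multiplies x by gamma and fixes the orthogonal complement of x satisfies kappa(S) = gamma,
  and S^-1 f_k(A) S nearly maps x to gamma u.

  That M_D(A) is finite at all follows from Newton interpolation at the spectrum: the divided
  differences of f are bounded by the maximum principle, and an annihilating polynomial of A
  stops the expansion.
*)
theory Submission
  imports Defs "HOL-Complex_Analysis.Conformal_Mappings"
    "HOL-Computational_Algebra.Fundamental_Theorem_Algebra"
begin

section \<open>Inverses, scalar matrices and the operator norm\<close>

lemma matrix_inv_right:
  fixes S :: "'a::field ^ 'n ^ 'n"
  assumes "invertible S"
  shows "S ** matrix_inv S = mat 1"
  using assms someI_ex[of "\<lambda>X. S ** X = mat 1 \<and> X ** S = mat 1"]
  unfolding invertible_def matrix_inv_def by blast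

lemma matrix_inv_left:
  fixes S :: "'a::field ^ 'n ^ 'n"
  assumes "invertible S"
  shows "matrix_inv S ** S = mat 1"
  using matrix_inv_right[OF assms] matrix_left_right_inverse by blast

lemma matrix_inv_unique:
  fixes S :: "'a::field ^ 'n ^ 'n"
  assumes "S ** T = mat 1"
  shows "invertible S" "matrix_inv S = T"
proof -
  show inv: "invertible S"
    using assms invertible_right_inverse by blast
  have "matrix_inv S = matrix_inv S ** (S ** T)"
    by (simp add: assms)
  also have "\<dots> = T"
    by (simp add: matrix_mul_assoc matrix_inv_left[OF inv])
  finally show "matrix_inv S = T" .
qed

lemma invertible_matrix_inv:
  fixes S :: "'a::field ^ 'n ^ 'n"
  assumes "invertible S"
  shows "invertible (matrix_inv S)"
  using matrix_inv_unique(1)[OF matrix_inv_left[OF assms]] .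

lemma matrix_inv_mult:
  fixes S T :: "'a::field ^ 'n ^ 'n"
  assumes "invertible S" "invertible T"
  shows "matrix_inv (S ** T) = matrix_inv T ** matrix_inv S"
proof (rule matrix_inv_unique(2))
  have "S ** T ** (matrix_inv T ** matrix_inv S) = S ** (T ** matrix_inv T) ** matrix_inv S"
    by (simp only: matrix_mul_assoc)
  then show "S ** T ** (matrix_inv T ** matrix_inv S) = mat 1"
    by (simp add: matrix_inv_right assms)
qed

lemma matrix_inv_matrix_inv:
  fixes S :: "'a::field ^ 'n ^ 'n"
  assumes "invertible S"
  shows "matrix_inv (matrix_inv S) = S"
  by (rule matrix_inv_unique(2)) (rule matrix_inv_left[OF assms])

lemma matrix_add_rdistrib:
  fixes X Y Z :: "'a::semiring_1 ^ 'n ^ 'n"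
  shows "(X + Y) ** Z = X ** Z + Y ** Z"
  by (simp add: matrix_matrix_mult_def vec_eq_iff sum.distrib distrib_right)

lemma mat_mult_component:
  fixes X :: "'a::comm_semiring_1 ^ 'n ^ 'n"
  shows "(mat c ** X) $ i $ j = c * X $ i $ j"
  by (simp add: matrix_matrix_mult_def mat_def if_distrib if_distribR cong: if_cong)

lemma mult_mat_component:
  fixes X :: "'a::comm_semiring_1 ^ 'n ^ 'n"
  shows "(X ** mat c) $ i $ j = c * X $ i $ j"
  by (simp add: matrix_matrix_mult_def mat_def if_distrib if_distribR mult.commute cong: if_cong)

text \<open>Scalars enter \<open>poly_matrix\<close> as scalar matrices \<open>mat c\<close>;
  centrality lets them be moved freely through products.\<close>

lemma mat_mult_commute:
  fixes X :: "'a::comm_semiring_1 ^ 'n ^ 'n"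
  shows "X ** mat c = mat c ** X"
  by (simp add: vec_eq_iff mat_mult_component mult_mat_component)

lemma mat_mult_left_commute:
  fixes X Y :: "'a::comm_semiring_1 ^ 'n ^ 'n"
  shows "X ** (mat c ** Y) = mat c ** (X ** Y)"
  by (metis mat_mult_commute matrix_mul_assoc)

lemma mat_mult_mat: "mat c ** mat d = (mat (c * d) :: 'a::comm_semiring_1 ^ 'n ^ 'n)"
  by (simp add: vec_eq_iff mat_mult_component) (simp add: mat_def)

lemma mat_add: "(mat (c + d) :: 'a::comm_ring_1 ^ 'n ^ 'n) = mat c + mat d"
  by (simp add: vec_eq_iff mat_def)

lemma mat_uminus: "(mat (- c) :: 'a::comm_ring_1 ^ 'n ^ 'n) = - mat c"
  by (simp add: vec_eq_iff mat_def)

lemma mat_mult_vector: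
  fixes v :: "'a::comm_semiring_1 ^ 'n"
  shows "mat c *v v = c *s v"
  by (simp add: vec_eq_iff matrix_vector_mult_def mat_def if_distrib if_distribR cong: if_cong)

lemma invertible_mat:
  assumes "c \<noteq> (0::'a::field)"
  shows "invertible (mat c :: 'a ^ 'n ^ 'n)"
  by (rule matrix_inv_unique(1)[where T = "mat (inverse c)"]) (simp add: mat_mult_mat assms)

lemma norm_vector_smult:
  fixes v :: "complex ^ 'n"
  shows "norm (c *s v) = cmod c * norm v"
  by (simp add: norm_vec_def norm_mult L2_set_right_distrib)

lemma opnorm_bound: "norm (B *v v) \<le> opnorm B * norm v"
  unfolding opnorm_def by (rule onorm) simp

lemma opnorm_nonneg: "0 \<le> opnorm B"
  unfolding opnorm_def by (rule onorm_pos_le) simp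

lemma opnorm_le:
  assumes "\<And>v. norm (B *v v) \<le> b * norm v"
  shows "opnorm B \<le> b"
  unfolding opnorm_def using assms by (rule onorm_le)

lemma opnorm_mult: "opnorm (X ** Y) \<le> opnorm X * opnorm Y"
proof (rule opnorm_le)
  fix v
  have "norm (X ** Y *v v) \<le> opnorm X * norm (Y *v v)"
    by (metis opnorm_bound matrix_vector_mul_assoc)
  also have "\<dots> \<le> opnorm X * (opnorm Y * norm v)"
    by (intro mult_left_mono opnorm_bound opnorm_nonneg)
  finally show "norm (X ** Y *v v) \<le> opnorm X * opnorm Y * norm v"
    by (simp add: mult.assoc)
qed

lemma opnorm_add: "opnorm (X + Y) \<le> opnorm X + opnorm Y"
proof (rule opnorm_le)
  fix v
  have "norm ((X + Y) *v v) \<le> norm (X *v v) + norm (Y *v v)"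
    by (simp add: matrix_vector_mult_add_rdistrib norm_triangle_ineq)
  also have "\<dots> \<le> opnorm X * norm v + opnorm Y * norm v"
    by (intro add_mono opnorm_bound)
  finally show "norm ((X + Y) *v v) \<le> (opnorm X + opnorm Y) * norm v"
    by (simp add: distrib_right)
qed

lemma opnorm_zero: "opnorm (0 :: complex ^ 'n ^ 'n) = 0"
  by (intro antisym opnorm_nonneg opnorm_le) simp

lemma opnorm_mat_mult: "opnorm (mat c ** X) \<le> cmod c * opnorm X"
proof (rule opnorm_le)
  fix v
  have "mat c ** X *v v = c *s (X *v v)"
    by (simp add: matrix_vector_mul_assoc[symmetric] mat_mult_vector)
  then show "norm (mat c ** X *v v) \<le> cmod c * opnorm X * norm v"
    using opnorm_bound[of X v] by (simp add: norm_vector_smult mult_left_mono mult.assoc)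
qed

section \<open>The polynomial functional calculus\<close>

text \<open>Padding with zero coefficients brings several polynomials to one summation range, so
  that sums can be compared termwise even when a degree drops.\<close>

lemma poly_matrix_bound:
  assumes "degree p \<le> n"
  shows "poly_matrix p B = (\<Sum>i\<le>n. mat (coeff p i) ** (((**) B ^^ i) (mat 1)))"
proof -
  have "(\<Sum>i\<le>n. mat (coeff p i) ** (((**) B ^^ i) (mat 1)))
      = (\<Sum>i\<le>degree p. mat (coeff p i) ** (((**) B ^^ i) (mat 1)))"
    using assms by (intro sum.mono_neutral_right) (auto simp: coeff_eq_0)
  then show ?thesis by (simp add: poly_matrix_def)
qed

lemma poly_matrix_add: "poly_matrix (p + q) B = poly_matrix p B + poly_matrix q B"
proof -
  let ?n = "max (degree p) (degree q)"
  have "degree (p + q) \<le> ?n" by (rule degree_add_le_max)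
  then show ?thesis
    by (simp add: poly_matrix_bound[of _ ?n] mat_add matrix_add_rdistrib sum.distrib)
qed

lemma sum_matrix_mult_right:
  fixes B :: "'a::semiring_1 ^ 'n ^ 'n"
  shows "B ** (\<Sum>i\<in>I. f i) = (\<Sum>i\<in>I. B ** f i)"
  by (induction I rule: infinite_finite_induct) (simp_all add: matrix_add_ldistrib)

lemma poly_matrix_smult: "poly_matrix (smult c p) B = mat c ** poly_matrix p B"
proof -
  have "degree (smult c p) \<le> degree p" by (rule degree_smult_le)
  then show ?thesis
    by (simp add: poly_matrix_bound[of _ "degree p"] sum_matrix_mult_right matrix_mul_assoc
        mat_mult_mat)
qed

text \<open>Horner's rule; inductions over polynomials run through it.\<close>

lemma poly_matrix_pCons: "poly_matrix (pCons a p) B = mat a + B ** poly_matrix p B"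
proof -
  have "poly_matrix (pCons a p) B
      = (\<Sum>i\<le>Suc (degree p). mat (coeff (pCons a p) i) ** (((**) B ^^ i) (mat 1)))"
    by (rule poly_matrix_bound[OF degree_pCons_le])
  also have "\<dots> = mat a + B ** (\<Sum>i\<le>degree p. mat (coeff p i) ** (((**) B ^^ i) (mat 1)))"
    by (simp add: sum.atMost_Suc_shift sum_matrix_mult_right mat_mult_left_commute
        del: sum.atMost_Suc)
  finally show ?thesis
    by (simp add: poly_matrix_def)
qed

lemma poly_matrix_0 [simp]: "poly_matrix 0 B = 0"
  by (simp add: poly_matrix_def)

lemma poly_matrix_const: "poly_matrix [:c:] B = mat c"
  by (simp add: poly_matrix_pCons)

lemma poly_matrix_linear: "poly_matrix [:- c, 1:] B = B - mat c"
  by (simp add: poly_matrix_pCons mat_uminus)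

lemma poly_matrix_mult: "poly_matrix (p * q) B = poly_matrix p B ** poly_matrix q B"
  by (induction p)
    (simp_all add: poly_matrix_add poly_matrix_smult poly_matrix_pCons matrix_add_rdistrib
      matrix_mul_assoc)

lemma poly_matrix_commute: "poly_matrix p B ** poly_matrix q B = poly_matrix q B ** poly_matrix p B"
  by (metis poly_matrix_mult mult.commute)

lemma poly_matrix_monom: "poly_matrix (monom c i) B = mat c ** ((**) B ^^ i) (mat 1)"
proof (induction i)
  case 0
  then show ?case by (simp add: monom_0 poly_matrix_const)
next
  case (Suc i)
  then show ?case
    by (simp add: monom_Suc poly_matrix_pCons mat_mult_left_commute)
qed

section \<open>Spectrum, root factors and annihilating polynomials\<close>

lemma spectrum_iff: "z \<in> spectrum B \<longleftrightarrow> \<not> invertible (B - mat z)"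
proof -
  have "invertible (- X)" if "invertible X" for X :: "complex ^ 'n ^ 'n"
  proof -
    have "- X = mat (- 1) ** X"
      by (simp add: vec_eq_iff mat_mult_component)
    then show ?thesis
      using that invertible_mult invertible_mat[of "- 1::complex"] by simp
  qed
  from this[of "mat z - B"] this[of "B - mat z"] show ?thesis
    by (auto simp: spectrum_def)
qed

lemma complex_poly_root_factor:
  fixes p :: "complex poly"
  assumes "degree p \<noteq> 0"
  obtains z r where "p = [:- z, 1:] * r" "degree p = Suc (degree r)" "r \<noteq> 0"
proof -
  have "\<not> constant (poly p)"
    using assms by (simp add: constant_degree)
  then obtain z where "poly p z = 0"
    using fundamental_theorem_of_algebra by blast
  then obtain r where r: "p = [:- z, 1:] * r"
    unfolding poly_eq_0_iff_dvd by (elim dvdE)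
  moreover have "r \<noteq> 0"
    using assms r by auto
  moreover from this have "degree p = Suc (degree r)"
    by (simp add: r degree_mult_eq del: mult_pCons_left)
  ultimately show ?thesis using that by blast
qed

text \<open>Over the complex numbers \<open>q(B)\<close> splits into a nonzero scalar and factors
  \<open>B - mat z\<close> with \<open>z\<close> a root of \<open>q\<close>; no such root is
  spectral, so every factor is invertible.\<close>

lemma invertible_poly_matrix:
  assumes "q \<noteq> 0" "\<And>z. z \<in> spectrum B \<Longrightarrow> poly q z \<noteq> 0"
  shows "invertible (poly_matrix q B)"
  using assms
proof (induction "degree q" arbitrary: q)
  case 0
  then obtain c where "q = [:c:]" by (metis degree_0_id)
  then show ?case using 0 by (auto simp: poly_matrix_const intro: invertible_mat)
next
  case (Suc n)
  then obtain z r where r: "q = [:- z, 1:] * r" "degree q = Suc (degree r)" "r \<noteq> 0"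
    by (metis complex_poly_root_factor nat.distinct(1))
  have "invertible (B - mat z)"
    using Suc.prems(2)[of z] r(1) spectrum_iff[of z B] by auto
  moreover have "invertible (poly_matrix r B)"
    using Suc.hyps r Suc.prems by (intro Suc.hyps(1)) (auto simp del: mult_pCons_left)
  ultimately show ?case
    unfolding r(1) poly_matrix_mult poly_matrix_linear by (rule invertible_mult)
qed

text \<open>More powers of \<open>B\<close> than the real dimension of the matrix space are linearly
  dependent, and a dependence is an annihilating polynomial.\<close>

lemma exists_annihilating_poly:
  fixes B :: "complex ^ 'n ^ 'n"
  shows "\<exists>p. p \<noteq> 0 \<and> poly_matrix p B = 0"
proof -
  let ?P = "\<lambda>i. ((**) B ^^ i) (mat 1)"
  let ?N = "DIM(complex ^ 'n ^ 'n)"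
  show ?thesis
  \<comment> \<open>Counting the set of powers requires distinct powers. If two coincide, the
    difference of their monomials already annihilates \<open>B\<close>.\<close>
  proof (cases "inj_on ?P {..?N}")
    case False
    then obtain i j where ij: "i \<noteq> j" "?P i = ?P j"
      unfolding inj_on_def by blast
    let ?p = "monom 1 i + monom (- 1) j :: complex poly"
    have "coeff ?p i = 1" using ij(1) by simp
    then have "?p \<noteq> 0" by (metis coeff_0 zero_neq_one)
    moreover have "poly_matrix ?p B = 0"
      by (simp add: poly_matrix_add poly_matrix_monom ij(2) matrix_add_rdistrib[symmetric]
          mat_add[symmetric] del: matrix_mul_lid)
    ultimately show ?thesis by blast
  next
    case True
    then have "card (?P ` {..?N}) > ?N"
      by (simp add: card_image)
    then have "dependent (?P ` {..?N})"
      by (intro dependent_biggerset)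
    then obtain u where u: "(\<Sum>v\<in>?P ` {..?N}. u v *\<^sub>R v) = 0" "\<exists>v\<in>?P ` {..?N}. u v \<noteq> 0"
      by (auto simp: real_vector.dependent_finite)
    let ?p = "\<Sum>i\<le>?N. monom (of_real (u (?P i))) i :: complex poly"
    have "poly_matrix (\<Sum>i\<in>I. monom (c i) i) B = (\<Sum>i\<in>I. poly_matrix (monom (c i) i) B)"
      if "finite I" for I and c :: "nat \<Rightarrow> complex"
      using that by induction (simp_all add: poly_matrix_add)
    then have "poly_matrix ?p B = (\<Sum>i\<le>?N. u (?P i) *\<^sub>R ?P i)"
      by (simp add: poly_matrix_monom) (simp add: vec_eq_iff mat_mult_component
          scaleR_conv_of_real[where 'a = complex])
    also have "\<dots> = 0"
      using u(1) unfolding sum.reindex[OF True] o_def .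
    finally have "poly_matrix ?p B = 0" .
    obtain k where k: "k \<le> ?N" "u (?P k) \<noteq> 0"
      using u(2) by auto
    have "coeff ?p k = (\<Sum>i\<le>?N. if i = k then of_real (u (?P i)) else 0)"
      by (simp add: coeff_sum)
    also have "\<dots> = of_real (u (?P k))"
      using k(1) by simp
    finally have "?p \<noteq> 0"
      using k(2) by (metis coeff_0 of_real_eq_0_iff)
    with \<open>poly_matrix ?p B = 0\<close> show ?thesis by blast
  qed
qed

section \<open>The optimal spectral constant\<close>

text \<open>Ensures that the \<open>SUP\<close> in \<open>spectral_set\<close> is a genuine upper
  bound.\<close>

lemma rational_bdd_above:
  fixes K :: "complex set"
  assumes "compact K" "\<And>z. z \<in> K \<Longrightarrow> poly q z \<noteq> 0"
  shows "bdd_above ((\<lambda>z. cmod (poly p z / poly q z)) ` K)"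
proof -
  have "continuous_on K (\<lambda>z. cmod (poly p z / poly q z))"
    using assms(2) by (intro continuous_intros) auto
  then show ?thesis
    using assms(1) by (intro bounded_imp_bdd_above compact_imp_bounded compact_continuous_image)
qed

text \<open>Together with \<open>spectral_setI\<close> this trades the supremum for an arbitrary
  bound \<open>m\<close>, so that later arguments need not handle \<open>SUP\<close>.\<close>

lemma spectral_set_bound:
  assumes "spectral_set C K B" "K \<noteq> {}" "\<And>z. z \<in> K \<Longrightarrow> poly q z \<noteq> 0"
    and "\<And>z. z \<in> K \<Longrightarrow> cmod (poly p z / poly q z) \<le> m"
  shows "opnorm (rational_matrix p q B) \<le> C * m"
proof -
  have C: "1 \<le> C" and
    le: "opnorm (rational_matrix p q B) \<le> C * (SUP z\<in>K. cmod (poly p z / poly q z))"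
    using assms(1,3) by (auto simp: spectral_set_def)
  have "(SUP z\<in>K. cmod (poly p z / poly q z)) \<le> m"
    using assms(2,4) by (rule cSUP_least)
  then have "C * (SUP z\<in>K. cmod (poly p z / poly q z)) \<le> C * m"
    using C by (simp add: mult_left_mono)
  with le show ?thesis by linarith
qed

lemma spectral_setI:
  assumes "compact K" "spectrum B \<subseteq> K" "1 \<le> C"
    and "\<And>p q m. (\<And>z. z \<in> K \<Longrightarrow> poly q z \<noteq> 0) \<Longrightarrow>
      (\<And>z. z \<in> K \<Longrightarrow> cmod (poly p z / poly q z) \<le> m) \<Longrightarrow>
      opnorm (rational_matrix p q B) \<le> C * m"
  shows "spectral_set C K B"
  unfolding spectral_set_def
  using assms(1-3) by (auto intro!: assms(4) cSUP_upper rational_bdd_above)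

text \<open>
  The set of spectral constants is closed, so as soon as it is nonempty its infimum belongs to it
  and \<open>LEAST\<close> is not a junk value.
\<close>

lemma optimal_spectral_constant:
  assumes "spectral_set C K B" "K \<noteq> {}"
  shows "spectral_set (optimal_spectral_constant K B) K B"
    and "optimal_spectral_constant K B \<le> C"
proof -
  let ?S = "{C. spectral_set C K B}"
  have bdd: "bdd_below ?S"
    by (rule bdd_belowI[of _ 1]) (simp add: spectral_set_def)
  have "?S \<noteq> {}" using assms by blast
  have K: "compact K" "spectrum B \<subseteq> K"
    using assms(1) by (auto simp: spectral_set_def)
  have Inf: "spectral_set (Inf ?S) K B"
  proof (rule spectral_setI[OF K])
    show "1 \<le> Inf ?S"
      using \<open>?S \<noteq> {}\<close> by (rule cInf_greatest) (simp add: spectral_set_def)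
  next
    fix p q m
    assume q: "\<And>z. z \<in> K \<Longrightarrow> poly q z \<noteq> 0"
      and m: "\<And>z. z \<in> K \<Longrightarrow> cmod (poly p z / poly q z) \<le> m"
    have le: "opnorm (rational_matrix p q B) \<le> C * m" if "C \<in> ?S" for C
      using that assms(2) q m by (intro spectral_set_bound) auto
    obtain z where "z \<in> K" using assms(2) by blast
    then have "0 \<le> m" using m[of z] norm_ge_zero order_trans by blast
    show "opnorm (rational_matrix p q B) \<le> Inf ?S * m"
    \<comment> \<open>Passing to the infimum divides by \<open>m\<close>; for \<open>m = 0\<close> a
      single spectral constant already forces the norm to vanish.\<close>
    proof (cases "m = 0")
      case True
      then show ?thesis using le assms(1) by auto
    next
      case False
      then have "0 < m" using \<open>0 \<le> m\<close> by simp
      have "opnorm (rational_matrix p q B) / m \<le> Inf ?S"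
        using \<open>?S \<noteq> {}\<close> le \<open>0 < m\<close> by (intro cInf_greatest) (auto simp: divide_simps)
      then show ?thesis using \<open>0 < m\<close> by (simp add: divide_simps)
    qed
  qed
  have "optimal_spectral_constant K B = Inf ?S"
    unfolding optimal_spectral_constant_def
    using Inf by (rule Least_equality[where P = "\<lambda>C. spectral_set C K B"])
      (simp add: cInf_lower bdd)
  then show "spectral_set (optimal_spectral_constant K B) K B"
    "optimal_spectral_constant K B \<le> C"
    using Inf assms(1) bdd by (auto intro: cInf_lower)
qed

section \<open>Finiteness of the optimal constant\<close>

text \<open>With \<open>f = p / q\<close>, the quotient \<open>r / q\<close> is the divided
  difference of \<open>f\<close> at \<open>w\<close>. On the frontier its numerator is at most
  \<open>2 * m\<close> and its denominator at least \<delta>; the maximum principle carries the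
  bound inside.\<close>

lemma divided_difference_bound:
  fixes D :: "complex set"
  assumes "open D" "bounded D" "ball w \<delta> \<subseteq> D" "0 < \<delta>"
    and q: "\<And>z. z \<in> closure D \<Longrightarrow> poly q z \<noteq> 0"
    and m: "\<And>z. z \<in> closure D \<Longrightarrow> cmod (poly p z / poly q z) \<le> m"
    and r: "p = smult (poly p w / poly q w) q + [:- w, 1:] * r"
    and z: "z \<in> closure D"
  shows "cmod (poly r z / poly q z) \<le> 2 / \<delta> * m"
proof -
  have "w \<in> closure D"
    using assms(3,4) closure_subset by (meson centre_in_ball subsetD)
  have frontier: "cmod (poly r z / poly q z) \<le> 2 / \<delta> * m" if "z \<in> frontier D" for z
  proof -
    have "z \<in> closure D" "z \<notin> D"
      using that assms(1) by (auto simp: frontier_def interior_open)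
    then have dist: "\<delta> \<le> cmod (z - w)"
      using assms(3) by (metis dist_norm dist_commute mem_ball not_less subsetD)
    have "poly p z = (poly p w / poly q w) * poly q z + (z - w) * poly r z"
      by (subst r) (simp add: algebra_simps)
    then have "poly p z / poly q z - poly p w / poly q w = (z - w) * (poly r z / poly q z)"
      using q[OF \<open>z \<in> closure D\<close>] by (simp add: field_simps)
    then have "cmod (z - w) * cmod (poly r z / poly q z) \<le> m + m"
      using m[OF \<open>z \<in> closure D\<close>] m[OF \<open>w \<in> closure D\<close>]
      by (metis norm_mult norm_triangle_le_diff add_mono)
    moreover have "\<delta> * cmod (poly r z / poly q z) \<le> cmod (z - w) * cmod (poly r z / poly q z)"
      using dist by (rule mult_right_mono) simp
    ultimately show ?thesis
      using assms(4) by (simp add: field_simps)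
  qed
  have cont: "continuous_on (closure D) (\<lambda>z. poly r z / poly q z)"
    using q by (intro continuous_intros) auto
  have "(\<lambda>z. poly r z / poly q z) holomorphic_on interior D"
    using q closure_subset[of D] interior_subset[of D] by (intro holomorphic_intros) blast
  from maximum_modulus_frontier[OF this cont assms(2)] frontier
  have "cmod (poly r z / poly q z) \<le> 2 / \<delta> * m" if "z \<in> D"
    using that by blast
  then show ?thesis
    using frontier z assms(1) by (auto simp: frontier_def interior_open)
qed

text \<open>
  Newton interpolation at spectral points: splitting off one root \<open>w\<close> of an annihilating
  polynomial replaces \<open>f\<close> by its divided difference at \<open>w\<close>, at the cost of a term \<open>f(w) X\<close>.
  Roots outside the spectrum are cancelled.
\<close>

lemma calculus_bounded_aux:
  fixes B X :: "complex ^ 'n ^ 'n"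
  assumes "open D" "bounded D" "spectrum B \<subseteq> D"
    and "a \<noteq> 0" "X ** poly_matrix a B = 0"
  shows "\<exists>C\<ge>0. \<forall>p q m. (\<forall>z\<in>closure D. poly q z \<noteq> 0) \<longrightarrow>
    (\<forall>z\<in>closure D. cmod (poly p z / poly q z) \<le> m) \<longrightarrow>
    opnorm (X ** rational_matrix p q B) \<le> C * m"
  using assms(4,5)
\<comment> \<open>\<open>X\<close> must vary: a spectral root \<open>w\<close> is absorbed by
  passing to \<open>X ** (B - mat w)\<close>, while a non-spectral root leaves \<open>X\<close>
  unchanged.\<close>
proof (induction "degree a" arbitrary: a X)
  case 0
  then obtain c where c: "a = [:c:]" by (metis degree_0_id)
  then have "c \<noteq> 0" using 0 by simp
  then have "X = X ** (mat c ** mat (inverse c))"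
    by (simp add: mat_mult_mat)
  also have "\<dots> = 0"
    using 0 by (simp add: c poly_matrix_const matrix_mul_assoc)
  finally show ?case
    by (intro exI[of _ 0]) (simp add: opnorm_zero)
next
  case (Suc n)
  then obtain w b where b: "a = [:- w, 1:] * b" "degree a = Suc (degree b)" "b \<noteq> 0"
    by (metis complex_poly_root_factor nat.distinct(1))
  show ?case
  proof (cases "w \<in> spectrum B")
    case False
    \<comment> \<open>Polynomials in \<open>B\<close> commute, so the factor can be moved to the
      right end and cancelled by its inverse.\<close>
    have "X ** poly_matrix b B ** (B - mat w) = 0"
      using Suc.prems(2) unfolding b(1)
      by (metis poly_matrix_mult poly_matrix_linear poly_matrix_commute matrix_mul_assoc)
    then have "X ** poly_matrix b B ** ((B - mat w) ** matrix_inv (B - mat w)) = 0"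
      by (simp add: matrix_mul_assoc)
    then have "X ** poly_matrix b B = 0"
      using False by (simp add: spectrum_iff matrix_inv_right)
    then show ?thesis
      using Suc.hyps b by auto
  next
    case True
    then have "w \<in> D" using assms(3) by blast
    then obtain \<delta> where \<delta>: "0 < \<delta>" "ball w \<delta> \<subseteq> D"
      using assms(1) open_contains_ball by blast
    have "X ** (B - mat w) ** poly_matrix b B = 0"
      using Suc.prems(2) unfolding b(1)
      by (simp only: poly_matrix_mult poly_matrix_linear matrix_mul_assoc)
    with Suc.hyps b obtain C where C: "0 \<le> C"
      "\<And>p q m. (\<forall>z\<in>closure D. poly q z \<noteq> 0) \<Longrightarrow>
        (\<forall>z\<in>closure D. cmod (poly p z / poly q z) \<le> m) \<Longrightarrow>
        opnorm (X ** (B - mat w) ** rational_matrix p q B) \<le> C * m"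
      by (metis Suc_inject)
    show ?thesis
    \<comment> \<open>The first summand pays for \<open>f(w) X\<close>, the second for the divided
      difference, whose bound is \<open>2 / \<delta> * m\<close>.\<close>
    proof (intro exI[of _ "opnorm X + C * (2 / \<delta>)"] conjI allI impI)
      show "0 \<le> opnorm X + C * (2 / \<delta>)"
        using C(1) \<delta>(1) opnorm_nonneg[of X] by simp
    next
      fix p q m
      assume q: "\<forall>z\<in>closure D. poly q z \<noteq> 0"
        and m: "\<forall>z\<in>closure D. cmod (poly p z / poly q z) \<le> m"
      have w: "w \<in> closure D" using \<open>w \<in> D\<close> closure_subset by blast
      define c where "c = poly p w / poly q w"
      have "poly (p - smult c q) w = 0"
        using q w by (simp add: c_def)
      then obtain r where "p - smult c q = [:- w, 1:] * r"
        unfolding poly_eq_0_iff_dvd by (elim dvdE)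
      then have r: "p = smult c q + [:- w, 1:] * r"
        by (metis add.commute diff_add_cancel)
      have "invertible (poly_matrix q B)"
        using q w assms(3) closure_subset[of D] by (intro invertible_poly_matrix) auto
      then have "rational_matrix p q B = mat c + (B - mat w) ** rational_matrix r q B"
        unfolding rational_matrix_def
        by (subst r) (simp add: poly_matrix_add poly_matrix_smult poly_matrix_mult
            poly_matrix_linear matrix_add_rdistrib matrix_mul_assoc[symmetric] matrix_inv_right
            del: mult_pCons_left)
      then have "X ** rational_matrix p q B
          = mat c ** X + X ** (B - mat w) ** rational_matrix r q B"
        by (simp add: matrix_add_ldistrib mat_mult_commute matrix_mul_assoc)
      moreover have "opnorm (mat c ** X) \<le> opnorm X * m"
      proof -
        have "cmod c * opnorm X \<le> m * opnorm X"
          using m w by (intro mult_right_mono) (auto simp: c_def opnorm_nonneg)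
        then show ?thesis
          using opnorm_mat_mult[of c X] by (simp add: mult.commute)
      qed
      moreover have "opnorm (X ** (B - mat w) ** rational_matrix r q B) \<le> C * (2 / \<delta> * m)"
        using q m r unfolding c_def
        by (intro C(2) ballI divided_difference_bound[OF assms(1,2) \<delta>(2,1)]) auto
      ultimately show "opnorm (X ** rational_matrix p q B) \<le> (opnorm X + C * (2 / \<delta>)) * m"
        using opnorm_add[of "mat c ** X" "X ** (B - mat w) ** rational_matrix r q B"]
        by (simp add: algebra_simps)
    qed
  qed
qed

text \<open>Starting the Newton expansion with \<open>X = mat 1\<close> yields some finite constant,
  so the least one exists. It is raised by \<open>max 1 C\<close> because spectral constants are at
  least 1.\<close>

lemma spectral_set_closure:
  fixes B :: "complex ^ 'n ^ 'n"
  assumes "open D" "bounded D" "D \<noteq> {}" "spectrum B \<subseteq> D"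
  shows "spectral_set (\<M> D B) (closure D) B"
proof -
  obtain a where a: "a \<noteq> 0" "mat 1 ** poly_matrix a B = 0"
    using exists_annihilating_poly[of B] by auto
  from calculus_bounded_aux[OF assms(1,2,4) a] obtain C where C: "0 \<le> C"
    "\<And>p q m. (\<forall>z\<in>closure D. poly q z \<noteq> 0) \<Longrightarrow>
      (\<forall>z\<in>closure D. cmod (poly p z / poly q z) \<le> m) \<Longrightarrow> opnorm (rational_matrix p q B) \<le> C * m"
    by auto
  obtain z where z: "z \<in> closure D" using assms(3) closure_subset by blast
  have "spectral_set (max 1 C) (closure D) B"
  proof (rule spectral_setI)
    show "compact (closure D)" using assms(2) by simp
    show "spectrum B \<subseteq> closure D" using assms(4) closure_subset by blast
    fix p q m
    assume q: "\<And>z. z \<in> closure D \<Longrightarrow> poly q z \<noteq> 0"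
      and m: "\<And>z. z \<in> closure D \<Longrightarrow> cmod (poly p z / poly q z) \<le> m"
    have "0 \<le> m" using m[OF z] norm_ge_zero order_trans by blast
    then have "C * m \<le> max 1 C * m" by (intro mult_right_mono) auto
    with C(2) q m show "opnorm (rational_matrix p q B) \<le> max 1 C * m"
      by (meson order_trans)
  qed simp
  then show ?thesis
    unfolding spectral_constant_on_def using assms(3) by (intro optimal_spectral_constant) auto
qed

section \<open>Similarity\<close>

lemma poly_matrix_similar:
  fixes B S :: "complex ^ 'n ^ 'n"
  assumes "invertible S"
  shows "poly_matrix p (matrix_inv S ** B ** S) = matrix_inv S ** poly_matrix p B ** S"
proof (induction p)
  case 0
  then show ?case by simp
next
  case (pCons a p)
  have "matrix_inv S ** mat a ** S = mat a"
    by (simp add: mat_mult_commute[of "matrix_inv S"] matrix_mul_assoc[symmetric] matrix_inv_left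
        assms)
  moreover have "matrix_inv S ** B ** S ** (matrix_inv S ** poly_matrix p B ** S)
      = matrix_inv S ** B ** (S ** matrix_inv S) ** poly_matrix p B ** S"
    by (simp only: matrix_mul_assoc)
  ultimately show ?case
    by (simp add: poly_matrix_pCons pCons.IH matrix_inv_right assms matrix_add_ldistrib
        matrix_add_rdistrib matrix_mul_assoc)
qed

lemma spectrum_similar:
  fixes B S :: "complex ^ 'n ^ 'n"
  assumes "invertible S"
  shows "spectrum (matrix_inv S ** B ** S) \<subseteq> spectrum B"
proof
  fix z
  assume z: "z \<in> spectrum (matrix_inv S ** B ** S)"
  have eq: "matrix_inv S ** B ** S - mat z = matrix_inv S ** (B - mat z) ** S"
    using poly_matrix_similar[OF assms, of "[:- z, 1:]" B] by (simp only: poly_matrix_linear)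
  show "z \<in> spectrum B"
  proof (rule ccontr)
    assume "z \<notin> spectrum B"
    then have "invertible (matrix_inv S ** (B - mat z) ** S)"
      by (intro invertible_mult invertible_matrix_inv assms) (simp add: spectrum_iff)
    with z eq show False by (simp add: spectrum_iff)
  qed
qed

lemma rational_matrix_similar:
  fixes B S :: "complex ^ 'n ^ 'n"
  assumes "invertible S" "invertible (poly_matrix q B)"
  shows "rational_matrix p q (matrix_inv S ** B ** S) = matrix_inv S ** rational_matrix p q B ** S"
proof -
  have "matrix_inv (matrix_inv S ** poly_matrix q B ** S)
      = matrix_inv S ** matrix_inv (poly_matrix q B) ** S"
    by (simp add: matrix_inv_mult invertible_mult invertible_matrix_inv assms matrix_inv_matrix_inv
        matrix_mul_assoc)
  then have "rational_matrix p q (matrix_inv S ** B ** S) = matrix_inv S ** poly_matrix p B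
      ** (S ** matrix_inv S) ** matrix_inv (poly_matrix q B) ** S"
    by (simp add: rational_matrix_def poly_matrix_similar assms matrix_mul_assoc
        del: matrix_mul_rid)
  then show ?thesis
    by (simp add: rational_matrix_def matrix_inv_right assms matrix_mul_assoc)
qed

text \<open>The upper bound of the theorem: conjugating \<open>f(B)\<close> by \<open>R\<close>
  costs at most the factor \<open>condition_number R\<close>.\<close>

lemma spectral_set_similar:
  fixes B R :: "complex ^ 'n ^ 'n"
  assumes "spectral_set C K B" "K \<noteq> {}" "invertible R" "condition_number R \<le> \<gamma>" "1 \<le> \<gamma>"
  shows "spectral_set (\<gamma> * C) K (matrix_inv R ** B ** R)"
proof (rule spectral_setI)
  show "compact K" using assms(1) by (simp add: spectral_set_def)
  have sp: "spectrum B \<subseteq> K" using assms(1) by (simp add: spectral_set_def)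
  then show "spectrum (matrix_inv R ** B ** R) \<subseteq> K"
    using spectrum_similar[OF assms(3), of B] by blast
  have C: "1 \<le> C" using assms(1) by (simp add: spectral_set_def)
  then show "1 \<le> \<gamma> * C" using assms(5) by (metis mult_mono' mult_1 zero_le_one)
  fix p q m
  assume q: "\<And>z. z \<in> K \<Longrightarrow> poly q z \<noteq> 0"
    and m: "\<And>z. z \<in> K \<Longrightarrow> cmod (poly p z / poly q z) \<le> m"
  have "invertible (poly_matrix q B)"
    using q sp assms(2) by (intro invertible_poly_matrix) auto
  note similar = rational_matrix_similar[OF assms(3) this, of p]
  let ?F = "rational_matrix p q B"
  have "opnorm (matrix_inv R ** ?F ** R) \<le> opnorm (matrix_inv R ** ?F) * opnorm R"
    by (rule opnorm_mult)
  also have "\<dots> \<le> opnorm (matrix_inv R) * opnorm ?F * opnorm R"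
    by (intro mult_right_mono opnorm_mult opnorm_nonneg)
  also have "\<dots> = condition_number R * opnorm ?F"
    by (simp add: condition_number_def)
  also have "\<dots> \<le> \<gamma> * opnorm ?F"
    using assms(4) by (intro mult_right_mono opnorm_nonneg)
  also have "\<dots> \<le> \<gamma> * (C * m)"
    using assms(5) spectral_set_bound[OF assms(1,2) q m] by (intro mult_left_mono) auto
  finally show "opnorm (rational_matrix p q (matrix_inv R ** B ** R)) \<le> \<gamma> * C * m"
    by (simp add: similar mult.assoc)
qed

section \<open>The Hermitian product and dilations along a vector\<close>

text \<open>The real inner product \<open>\<bullet>\<close> is only the real part of this Hermitian
  product, so it does not express complex orthogonality.\<close>

definition hinner :: "complex ^ 'n \<Rightarrow> complex ^ 'n \<Rightarrow> complex" where
  "hinner u v = (\<Sum>i\<in>UNIV. u $ i * cnj (v $ i))"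

lemma Re_hinner: "Re (hinner u v) = u \<bullet> v"
  by (simp add: hinner_def inner_vec_def inner_complex_def)

lemma hinner_add_left: "hinner (u + v) w = hinner u w + hinner v w"
  by (simp add: hinner_def distrib_right sum.distrib)

lemma hinner_smult_left: "hinner (c *s u) v = c * hinner u v"
  by (simp add: hinner_def sum_distrib_left mult.assoc)

lemma hinner_smult_right: "hinner u (c *s v) = cnj c * hinner u v"
  by (simp add: hinner_def sum_distrib_left mult_ac)

lemma cnj_hinner: "cnj (hinner u v) = hinner v u"
  by (simp add: hinner_def mult.commute)

lemma hinner_self: "hinner v v = of_real ((norm v)\<^sup>2)"
proof (rule complex_eqI)
  show "Re (hinner v v) = Re (of_real ((norm v)\<^sup>2))"
    by (simp add: Re_hinner power2_norm_eq_inner)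
  show "Im (hinner v v) = Im (of_real ((norm v)\<^sup>2))"
    by (simp add: hinner_def)
qed

lemma norm_add_smult:
  "(norm (u + c *s v))\<^sup>2 = (norm u)\<^sup>2 + (cmod c)\<^sup>2 * (norm v)\<^sup>2 + 2 * Re (cnj c * hinner u v)"
  for u v :: "complex ^ 'n"
proof -
  have "(norm (u + c *s v))\<^sup>2 = (norm u)\<^sup>2 + (norm (c *s v))\<^sup>2 + 2 * (u \<bullet> (c *s v))"
    by (simp add: power2_norm_eq_inner inner_add_left inner_add_right inner_commute)
  then show ?thesis
    by (simp add: Re_hinner[symmetric] hinner_smult_right norm_vector_smult power_mult_distrib)
qed

text \<open>Complex Cauchy-Schwarz from the real one: a unimodular factor \<open>d\<close> rotates
  \<open>u\<close> until the product equals its own modulus.\<close>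

lemma cmod_hinner_le: "cmod (hinner u v) \<le> norm u * norm v"
proof (cases "hinner u v = 0")
  case False
  define d where "d = cnj (hinner u v) / of_real (cmod (hinner u v))"
  have d: "cmod d = 1"
    using False by (simp add: d_def norm_divide)
  have "hinner (d *s u) v = of_real (cmod (hinner u v))"
    using False by (simp add: hinner_smult_left d_def complex_norm_square[symmetric]
        power2_eq_square mult.commute)
  then have "cmod (hinner u v) = (d *s u) \<bullet> v"
    by (metis Re_hinner Re_complex_of_real)
  also have "\<dots> \<le> norm (d *s u) * norm v"
    by (rule norm_cauchy_schwarz)
  finally show ?thesis by (simp add: norm_vector_smult d)
qed simp

text \<open>The rank-one perturbation \<open>I + (c - 1) x x^*\<close>. For a unit vector
  \<open>x\<close> it multiplies \<open>x\<close> by \<open>c\<close> and fixes the orthogonal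
  complement.\<close>

definition dilation :: "complex ^ 'n \<Rightarrow> real \<Rightarrow> complex ^ 'n ^ 'n" where
  "dilation x c = mat 1 + (\<chi> i j. (of_real c - 1) * x $ i * cnj (x $ j))"

lemma dilation_vector: "dilation x c *v v = v + ((of_real c - 1) * hinner v x) *s x"
  by (simp add: dilation_def matrix_vector_mult_add_rdistrib)
    (simp add: vec_eq_iff matrix_vector_mult_def hinner_def sum_distrib_left sum_distrib_right
      mult_ac)

lemma dilation_fixes:
  assumes "hinner v x = 0"
  shows "dilation x c *v v = v"
  by (simp add: dilation_vector assms)

context
  fixes x :: "complex ^ 'n"
  assumes x: "norm x = 1"
begin

lemma dilation_self: "dilation x c *v x = of_real c *s x"
  using x by (simp add: dilation_vector hinner_self vec_eq_iff algebra_simps)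

lemma dilation_mult: "dilation x c ** dilation x d = dilation x (c * d)"
  using x by (simp add: matrix_eq matrix_vector_mul_assoc[symmetric] dilation_vector
      hinner_add_left hinner_smult_left hinner_self vec_eq_iff algebra_simps)

lemma dilation_inverse:
  assumes "c \<noteq> 0"
  shows "invertible (dilation x c)" "matrix_inv (dilation x c) = dilation x (1 / c)"
proof -
  have "dilation x c ** dilation x (1 / c) = mat 1"
    using assms by (simp add: dilation_mult) (simp add: dilation_def vec_eq_iff)
  from matrix_inv_unique[OF this]
  show "invertible (dilation x c)" "matrix_inv (dilation x c) = dilation x (1 / c)" .
qed

text \<open>Pythagoras: only the component along \<open>x\<close> changes length.\<close>

lemma norm_dilation_vector:
  "(norm (dilation x c *v v))\<^sup>2 = (norm v)\<^sup>2 + (c\<^sup>2 - 1) * (cmod (hinner v x))\<^sup>2"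
proof -
  have "cmod (of_real c - 1) ^ 2 = (c - 1)\<^sup>2"
    by (metis norm_of_real of_real_1 of_real_diff power2_abs)
  moreover have "Re (cnj ((of_real c - 1) * hinner v x) * hinner v x)
      = (c - 1) * (cmod (hinner v x))\<^sup>2"
    by (simp add: cmod_power2) (simp add: power2_eq_square algebra_simps)
  ultimately show ?thesis
    using x by (simp add: dilation_vector norm_add_smult norm_mult power_mult_distrib)
      (simp add: power2_eq_square algebra_simps)
qed

lemma cmod_hinner_square_le: "(cmod (hinner v x))\<^sup>2 \<le> (norm v)\<^sup>2"
  using cmod_hinner_le[of v x] x by (simp add: power_mono)

lemma opnorm_dilation_ge_1:
  assumes "1 \<le> c"
  shows "opnorm (dilation x c) = c"
proof (rule antisym)
  show "opnorm (dilation x c) \<le> c"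
  proof (rule opnorm_le)
    fix v
    have "(c\<^sup>2 - 1) * (cmod (hinner v x))\<^sup>2 \<le> (c\<^sup>2 - 1) * (norm v)\<^sup>2"
      using assms by (intro mult_left_mono cmod_hinner_square_le) simp
    then have "(norm (dilation x c *v v))\<^sup>2 \<le> (c * norm v)\<^sup>2"
      by (simp add: norm_dilation_vector power_mult_distrib algebra_simps)
    then show "norm (dilation x c *v v) \<le> c * norm v"
      using assms by (simp add: power2_le_iff_abs_le abs_mult)
  qed
  show "c \<le> opnorm (dilation x c)"
    using opnorm_bound[of "dilation x c" x] assms x
    by (simp add: dilation_self norm_vector_smult)
qed

text \<open>The fixed vector \<open>y\<close> attains the norm 1. In dimension one no such
  \<open>y\<close> exists and the norm would be \<open>c\<close>.\<close>

lemma opnorm_dilation_le_1: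
  assumes "0 \<le> c" "c \<le> 1" and y: "hinner y x = 0" "y \<noteq> 0"
  shows "opnorm (dilation x c) = 1"
proof (rule antisym)
  show "opnorm (dilation x c) \<le> 1"
  proof (rule opnorm_le)
    fix v
    have "(c\<^sup>2 - 1) * (cmod (hinner v x))\<^sup>2 \<le> 0"
      using assms by (intro mult_nonpos_nonneg) (auto simp: power_le_one)
    then have "(norm (dilation x c *v v))\<^sup>2 \<le> (norm v)\<^sup>2"
      by (simp add: norm_dilation_vector)
    then show "norm (dilation x c *v v) \<le> 1 * norm v"
      by (simp add: power2_le_iff_abs_le)
  qed
  show "1 \<le> opnorm (dilation x c)"
    using opnorm_bound[of "dilation x c" y] y by (simp add: dilation_fixes)
qed

lemma condition_number_dilation:
  assumes "1 \<le> c" "hinner y x = 0" "y \<noteq> 0"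
  shows "condition_number (dilation x c) = c"
  using assms opnorm_dilation_ge_1[of c] opnorm_dilation_le_1[of "1 / c" y]
  by (simp add: condition_number_def dilation_inverse)

lemma positive_dilation:
  assumes "1 \<le> c"
  shows "positive_matrix (dilation x c)"
  unfolding positive_matrix_def
proof
  fix v
  have "(\<Sum>i\<in>UNIV. (dilation x c *v v) $ i * cnj (v $ i)) = hinner (dilation x c *v v) v"
    by (simp add: hinner_def)
  also have "\<dots> = of_real ((norm v)\<^sup>2) + (of_real c - 1) * (hinner v x * cnj (hinner v x))"
    by (simp add: dilation_vector hinner_add_left hinner_smult_left hinner_self cnj_hinner)
  also have "\<dots> = of_real ((norm v)\<^sup>2 + (c - 1) * (cmod (hinner v x))\<^sup>2)"
    by (simp only: complex_norm_square[symmetric]) simp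
  also have "\<dots> \<in> \<real>\<^sub>\<ge>\<^sub>0"
    using assms by (simp only: nonneg_Reals_of_real_iff) simp
  finally show "(\<Sum>i\<in>UNIV. (dilation x c *v v) $ i * cnj (v $ i)) \<in> \<real>\<^sub>\<ge>\<^sub>0" .
qed

end

section \<open>Extremal vectors\<close>

text \<open>Compare both sides to first order at \<open>a = - t \<langle>u, x\<rangle>\<close> for small \<open>t\<close>.\<close>

lemma extremal_orthogonal:
  fixes u x :: "complex ^ 'n"
  assumes "norm x = 1" "norm u = M" "1 < M"
    and ineq: "\<And>a. cmod a < 1 \<Longrightarrow> norm (u + a *s x) \<le> M * norm (x + cnj a *s u)"
  shows "hinner u x = 0"
proof (rule ccontr)
  define c where "c = hinner u x"
  assume "hinner u x \<noteq> 0"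
  then have c: "0 < (cmod c)\<^sup>2" by (simp add: c_def)
  \<comment> \<open>Small enough both for \<open>cmod a < 1\<close> and for
    \<open>t * (M\<^sup>2 + 1)\<close> to stay below the value 2 that the inequality will
    force.\<close>
  define t where "t = 1 / (M\<^sup>2 + 1 + cmod c)"
  have den: "0 < M\<^sup>2 + 1 + cmod c"
    using assms(3) by (intro add_pos_nonneg) auto
  then have t: "0 < t" "t * (M\<^sup>2 + 1) \<le> 1" "t * cmod c < 1"
    by (auto simp: t_def divide_simps intro: add_nonneg_pos)
  let ?a = "- (of_real t * c)"
  have a: "cmod ?a < 1"
    using t by (simp add: norm_mult)
  have sq: "(cmod ?a)\<^sup>2 = t\<^sup>2 * (cmod c)\<^sup>2"
    using t by (simp add: norm_mult power_mult_distrib)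
  have cross: "Re (cnj ?a * c) = - t * (cmod c)\<^sup>2"
    by (simp add: cmod_power2) (simp add: power2_eq_square algebra_simps)
  have cross': "Re (?a * hinner x u) = - t * (cmod c)\<^sup>2"
    by (simp add: cnj_hinner[of u x, symmetric] c_def[symmetric] cmod_power2)
      (simp add: power2_eq_square algebra_simps)
  have "(norm (u + ?a *s x))\<^sup>2 \<le> (M * norm (x + cnj ?a *s u))\<^sup>2"
    using ineq[OF a] by (intro power_mono) auto
  then have "M\<^sup>2 + t\<^sup>2 * (cmod c)\<^sup>2 - 2 * t * (cmod c)\<^sup>2
      \<le> M\<^sup>2 * (1 + t\<^sup>2 * (cmod c)\<^sup>2 * M\<^sup>2 - 2 * t * (cmod c)\<^sup>2)"
    unfolding power_mult_distrib norm_add_smult complex_mod_cnj sq complex_cnj_cnj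
      c_def[symmetric] cross cross' assms(1,2) by (simp add: algebra_simps)
  \<comment> \<open>The difference of the two sides contains the factor
    \<open>M\<^sup>2 - 1\<close>, which is positive because \<open>M > 1\<close>.\<close>
  then have "0 \<le> (M\<^sup>2 - 1) * (t * (cmod c)\<^sup>2) * (t * (M\<^sup>2 + 1) - 2)"
    by (simp add: algebra_simps power2_eq_square)
  moreover have "0 < (M\<^sup>2 - 1) * (t * (cmod c)\<^sup>2)"
    using assms(3) t(1) c by (intro mult_pos_pos) (auto simp: one_less_power)
  ultimately have "2 \<le> t * (M\<^sup>2 + 1)"
    by (simp add: zero_le_mult_iff)
  with t(2) show False by simp
qed

text \<open>Homogeneous form, free of division, of the fact that Moebius maps preserve the unit
  disc; it is used with \<open>z\<close>, \<open>w\<close> the values of \<open>p\<close>,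
  \<open>q\<close>.\<close>

lemma moebius_identity:
  "(cmod (w + cnj a * z))\<^sup>2 - (cmod (z + a * w))\<^sup>2
    = (1 - (cmod a)\<^sup>2) * ((cmod w)\<^sup>2 - (cmod z)\<^sup>2)"
  unfolding of_real_eq_iff[symmetric, where 'a = complex] of_real_diff of_real_mult
    complex_norm_square
  by (simp add: algebra_simps)

text \<open>Apply the spectral constant to the Moebius transform \<open>(f + a) / (1 + cnj a f)\<close> of \<open>f = p / q\<close>.\<close>

lemma spectral_set_moebius:
  fixes B :: "complex ^ 'n ^ 'n"
  assumes "spectral_set C K B" "K \<noteq> {}" and q: "\<And>z. z \<in> K \<Longrightarrow> poly q z \<noteq> 0"
    and le: "\<And>z. z \<in> K \<Longrightarrow> cmod (poly p z / poly q z) \<le> 1" and a: "cmod a < 1"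
  shows "norm (rational_matrix p q B *v v + a *s v)
    \<le> C * norm (v + cnj a *s (rational_matrix p q B *v v))"
proof -
  \<comment> \<open>Numerator and denominator of the Moebius transform after multiplying both by
    \<open>q\<close>.\<close>
  define p' q' where "p' = p + smult a q" and "q' = q + smult (cnj a) p"
  have sp: "spectrum B \<subseteq> K" using assms(1) by (simp add: spectral_set_def)
  have pq: "cmod (poly p z) \<le> cmod (poly q z)" "poly q z \<noteq> 0" if "z \<in> K" for z
    using le[OF that] q[OF that] by (auto simp: norm_divide divide_simps)
  have q': "poly q' z \<noteq> 0" if "z \<in> K" for z
  proof
    assume "poly q' z = 0"
    then have "poly q z = - (cnj a * poly p z)"
      by (simp add: q'_def add_eq_0_iff2)
    then have "cmod (poly q z) = cmod a * cmod (poly p z)"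
      by (metis norm_minus_cancel norm_mult complex_mod_cnj)
    also have "\<dots> \<le> cmod a * cmod (poly q z)"
      using pq[OF that] by (intro mult_left_mono) auto
    also have "\<dots> < cmod (poly q z)"
      using a pq[OF that] by simp
    finally show False by simp
  qed
  have le': "cmod (poly p' z / poly q' z) \<le> 1" if "z \<in> K" for z
  proof -
    have "(cmod (poly q' z))\<^sup>2 - (cmod (poly p' z))\<^sup>2
        = (1 - (cmod a)\<^sup>2) * ((cmod (poly q z))\<^sup>2 - (cmod (poly p z))\<^sup>2)"
      unfolding p'_def q'_def poly_add poly_smult by (rule moebius_identity)
    also have "0 \<le> \<dots>"
    proof (rule mult_nonneg_nonneg)
      show "0 \<le> 1 - (cmod a)\<^sup>2"
        using power_le_one[of "cmod a" 2] a by simp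
      show "0 \<le> (cmod (poly q z))\<^sup>2 - (cmod (poly p z))\<^sup>2"
        using power_mono[OF pq(1)[OF that], of 2] by simp
    qed
    finally have "cmod (poly p' z) \<le> cmod (poly q' z)"
      using power2_le_imp_le[OF _ norm_ge_zero] by simp
    then show ?thesis
      using q'[OF that] by (simp add: norm_divide divide_simps)
  qed
  have inv: "invertible (poly_matrix q B)" "invertible (poly_matrix q' B)"
    using q q' sp assms(2) by (auto intro!: invertible_poly_matrix)
  let ?F = "rational_matrix p q B" and ?G = "rational_matrix p' q' B"
  have num: "poly_matrix p' B ** matrix_inv (poly_matrix q B) = ?F + mat a"
    by (simp add: p'_def poly_matrix_add poly_matrix_smult matrix_add_rdistrib rational_matrix_def
        matrix_mul_assoc[symmetric] matrix_inv_right inv)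
  have den: "poly_matrix q' B ** matrix_inv (poly_matrix q B) = mat 1 + mat (cnj a) ** ?F"
    by (simp add: q'_def poly_matrix_add poly_matrix_smult matrix_add_rdistrib rational_matrix_def
        matrix_mul_assoc[symmetric] matrix_inv_right inv)
  \<comment> \<open>Inserting \<open>q'(B)\<close> and its inverse gives the matrix form of
    \<open>f + a = g (1 + cnj a f)\<close>, with \<open>g = p' / q'\<close>.\<close>
  have "?F + mat a = poly_matrix p' B ** (matrix_inv (poly_matrix q' B) ** poly_matrix q' B)
      ** matrix_inv (poly_matrix q B)"
    by (simp add: matrix_inv_left inv num)
  also have "\<dots> = ?G ** (mat 1 + mat (cnj a) ** ?F)"
    by (simp only: rational_matrix_def[of p'] den[symmetric] matrix_mul_assoc)
  finally have "?F *v v + a *s v = ?G *v (v + cnj a *s (?F *v v))"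
    by (metis matrix_vector_mul_assoc matrix_vector_mult_add_rdistrib mat_mult_vector
        matrix_vector_mul_lid)
  also have "norm \<dots> \<le> opnorm ?G * norm (v + cnj a *s (?F *v v))"
    by (rule opnorm_bound)
  also have "\<dots> \<le> C * norm (v + cnj a *s (?F *v v))"
    using spectral_set_bound[OF assms(1,2) q' le'] by (intro mult_right_mono) auto
  finally show ?thesis .
qed

text \<open>A violating quotient is divided by its supremum over \<open>K\<close>, and a vector on
  which the violation shows is normalized.\<close>

lemma not_spectral_set_witness:
  fixes B :: "complex ^ 'n ^ 'n"
  assumes "compact K" "infinite K" "spectrum B \<subseteq> K" "1 \<le> C" "\<not> spectral_set C K B"
  shows "\<exists>p q v. (\<forall>z\<in>K. poly q z \<noteq> 0) \<and> (\<forall>z\<in>K. cmod (poly p z / poly q z) \<le> 1) \<and>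
    norm v = 1 \<and> C < norm (rational_matrix p q B *v v)"
proof -
  from assms obtain p q where q: "\<And>z. z \<in> K \<Longrightarrow> poly q z \<noteq> 0"
    and big: "C * (SUP z\<in>K. cmod (poly p z / poly q z)) < opnorm (rational_matrix p q B)"
    by (auto simp: spectral_set_def not_le)
  define m where "m = (SUP z\<in>K. cmod (poly p z / poly q z))"
  have le: "cmod (poly p z / poly q z) \<le> m" if "z \<in> K" for z
    unfolding m_def using that rational_bdd_above[OF assms(1) q] by (intro cSUP_upper) auto
  obtain z0 where "z0 \<in> K" using assms(2) by (metis ex_in_conv finite.emptyI)
  then have "0 \<le> m" using le[of z0] norm_ge_zero order_trans by blast
  \<comment> \<open>A numerator vanishing on the infinite set \<open>K\<close> is the zero
    polynomial, which violates no bound.\<close>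
  moreover have "m \<noteq> 0"
  proof
    assume "m = 0"
    then have "poly p z = 0" if "z \<in> K" for z
      using le[OF that] q[OF that] by simp
    then have "K \<subseteq> {z. poly p z = 0}" by blast
    then have "p = 0" using assms(2) poly_roots_finite finite_subset by blast
    then have "opnorm (rational_matrix p q B) = 0"
      by (simp add: rational_matrix_def opnorm_zero)
    with big \<open>m = 0\<close> show False by (simp add: m_def)
  qed
  ultimately have m: "0 < m" by simp
  have "\<exists>w. C * m * norm w < norm (rational_matrix p q B *v w)"
    using big opnorm_le[of "rational_matrix p q B" "C * m"] by (force simp: m_def not_le)
  then obtain w where w: "C * m * norm w < norm (rational_matrix p q B *v w)" by blast
  then have "w \<noteq> 0" by auto
  define v where "v = of_real (1 / norm w) *s w"
  define P where "P = smult (of_real (1 / m)) p"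
  have "norm v = 1" using \<open>w \<noteq> 0\<close> by (simp add: v_def norm_vector_smult norm_divide)
  moreover have "cmod (poly P z / poly q z) \<le> 1" if "z \<in> K" for z
  proof -
    have "cmod (poly P z / poly q z) = cmod (poly p z / poly q z) / m"
      using m by (simp add: P_def norm_divide norm_mult)
    then show ?thesis using le[OF that] m by (simp only: divide_le_eq_1_pos)
  qed
  moreover have "C < norm (rational_matrix P q B *v v)"
  proof -
    have "rational_matrix P q B *v v
        = of_real (1 / norm w) *s (of_real (1 / m) *s (rational_matrix p q B *v w))"
      by (simp only: P_def rational_matrix_def poly_matrix_smult v_def
          matrix_vector_mul_assoc[symmetric] mat_mult_vector vector_scalar_commute)
    then have "norm (rational_matrix P q B *v v) = norm (rational_matrix p q B *v w) / (m * norm w)"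
      using m by (simp add: norm_vector_smult norm_divide norm_mult)
    then show ?thesis
      using w m \<open>w \<noteq> 0\<close> by (simp only: less_divide_eq) (simp add: mult.assoc)
  qed
  ultimately show ?thesis using q by blast
qed

section \<open>Limits of maximizing sequences\<close>

lemma tendsto_vector_smult:
  fixes f :: "'a \<Rightarrow> complex ^ 'n"
  assumes "(f \<longlongrightarrow> l) F"
  shows "((\<lambda>t. c *s f t) \<longlongrightarrow> c *s l) F"
proof (rule vec_tendstoI)
  show "((\<lambda>t. (c *s f t) $ i) \<longlongrightarrow> (c *s l) $ i) F" for i
    unfolding vector_smult_component by (intro tendsto_mult tendsto_const tendsto_vec_nth assms)
qed

lemma tendsto_matrix_vector_mult:
  fixes f :: "'a \<Rightarrow> complex ^ 'n"
  assumes "(f \<longlongrightarrow> l) F"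
  shows "((\<lambda>t. B *v f t) \<longlongrightarrow> B *v l) F"
  using matrix_vector_mul_bounded_linear assms by (rule bounded_linear.tendsto)

text \<open>
  No extremal function is needed: only the two vectors \<open>x\<close> and \<open>u\<close>, the limit of \<open>f\<^sub>k(B) x\<^sub>k\<close>
  along a maximizing sequence, matter.
\<close>

lemma extremal_sequence:
  fixes B :: "complex ^ 'n ^ 'n"
  assumes "infinite K" "spectral_set M K B" "1 < M"
    and least: "\<forall>C. spectral_set C K B \<longrightarrow> M \<le> C"
  obtains q p X x u where "\<forall>k. \<forall>z\<in>K. poly (q k) z \<noteq> 0"
    "\<forall>k. \<forall>z\<in>K. cmod (poly (p k) z / poly (q k) z) \<le> 1"
    "X \<longlonglongrightarrow> x" "(\<lambda>k. rational_matrix (p k) (q k) B *v X k) \<longlonglongrightarrow> u"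
    "norm x = 1" "norm u = M" "hinner u x = 0"
proof -
  have K: "compact K" "spectrum B \<subseteq> K" "K \<noteq> {}"
    using assms(1,2) by (auto simp: spectral_set_def)
  \<comment> \<open>Constants increasing from 1 to \<open>M\<close> without reaching it; by
    leastness of \<open>M\<close> none is spectral, so each supplies a witness.\<close>
  define C where "C k = M - (M - 1) / real (Suc k)" for k
  have C: "1 \<le> C k" "C k < M" for k
  proof -
    have "(M - 1) / real (Suc k) \<le> M - 1" "0 < (M - 1) / real (Suc k)"
      using assms(3) by (auto simp: divide_simps)
    then show "1 \<le> C k" "C k < M" by (auto simp: C_def)
  qed
  have "\<exists>p q v. (\<forall>z\<in>K. poly q z \<noteq> 0) \<and> (\<forall>z\<in>K. cmod (poly p z / poly q z) \<le> 1) \<and>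
      norm v = 1 \<and> C k < norm (rational_matrix p q B *v v)" for k
  proof -
    have "\<not> spectral_set (C k) K B" using least C(2)[of k] by force
    then show ?thesis
      by (rule not_spectral_set_witness[OF K(1) assms(1) K(2) C(1)])
  qed
  then obtain p q V where q: "\<And>k z. z \<in> K \<Longrightarrow> poly (q k) z \<noteq> 0"
    and p: "\<And>k z. z \<in> K \<Longrightarrow> cmod (poly (p k) z / poly (q k) z) \<le> 1"
    and V: "\<And>k. norm (V k) = 1" "\<And>k. C k < norm (rational_matrix (p k) (q k) B *v V k)"
    by metis
  let ?U = "\<lambda>k. rational_matrix (p k) (q k) B *v V k"
  have U: "norm (?U k) \<le> M" for k
  proof -
    have "norm (?U k) \<le> opnorm (rational_matrix (p k) (q k) B)"
      using opnorm_bound[of "rational_matrix (p k) (q k) B" "V k"] V(1)[of k] by simp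
    also have "\<dots> \<le> M"
      using spectral_set_bound[OF assms(2) K(3) q p, of k] by simp
    finally show ?thesis .
  qed
  \<comment> \<open>Pairing the vectors yields one subsequence along which both converge.\<close>
  have "\<forall>k. (V k, ?U k) \<in> cball 0 1 \<times> cball 0 M"
    using V(1) U by simp
  moreover have "compact (cball (0 :: complex ^ 'n) 1 \<times> cball (0 :: complex ^ 'n) M)"
    by (intro compact_Times compact_cball)
  ultimately obtain l r where r: "strict_mono r" "((\<lambda>k. (V k, ?U k)) \<circ> r) \<longlonglongrightarrow> l"
    by (elim seq_compactE[OF compact_imp_seq_compact])
  define x u where "x = fst l" and "u = snd l"
  have x: "(\<lambda>k. V (r k)) \<longlonglongrightarrow> x" and u: "(\<lambda>k. ?U (r k)) \<longlonglongrightarrow> u"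
    using tendsto_fst[OF r(2)] tendsto_snd[OF r(2)] by (simp_all add: x_def u_def o_def)
  have "norm x = 1"
    using tendsto_norm[OF x] V(1) by (simp add: LIMSEQ_const_iff)
  have "C \<longlonglongrightarrow> M - 0"
    unfolding C_def by (rule tendsto_diff[OF tendsto_const LIMSEQ_Suc[OF lim_const_over_n]])
  then have "(\<lambda>k. C (r k)) \<longlonglongrightarrow> M"
    using LIMSEQ_subseq_LIMSEQ[OF _ r(1), of C M] by (simp add: o_def)
  then have "(\<lambda>k. norm (?U (r k))) \<longlonglongrightarrow> M"
    by (rule tendsto_sandwich[rotated 2, OF _ tendsto_const])
      (use V(2) U in \<open>simp_all add: less_imp_le\<close>)
  then have "norm u = M"
    using tendsto_norm[OF u] LIMSEQ_unique by blast
  moreover have "hinner u x = 0"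
  proof (rule extremal_orthogonal[OF \<open>norm x = 1\<close> \<open>norm u = M\<close> assms(3)])
    fix a :: complex
    assume a: "cmod a < 1"
    show "norm (u + a *s x) \<le> M * norm (x + cnj a *s u)"
    proof (rule LIMSEQ_le)
      show "(\<lambda>k. norm (?U (r k) + a *s V (r k))) \<longlonglongrightarrow> norm (u + a *s x)"
        by (intro tendsto_intros tendsto_vector_smult x u)
      show "(\<lambda>k. M * norm (V (r k) + cnj a *s ?U (r k))) \<longlonglongrightarrow> M * norm (x + cnj a *s u)"
        by (intro tendsto_intros tendsto_vector_smult x u)
      show "\<exists>N. \<forall>k\<ge>N. norm (?U (r k) + a *s V (r k)) \<le> M * norm (V (r k) + cnj a *s ?U (r k))"
        using spectral_set_moebius[OF assms(2) K(3) q p a] by blast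
    qed
  qed
  ultimately have ux: "norm u = M" "hinner u x = 0" by simp_all
  have "\<forall>k. \<forall>z\<in>K. poly (q (r k)) z \<noteq> 0"
    "\<forall>k. \<forall>z\<in>K. cmod (poly (p (r k)) z / poly (q (r k)) z) \<le> 1"
    using q p by simp_all
  from that[OF this x u \<open>norm x = 1\<close> ux] show thesis .
qed

text \<open>
  With \<open>S\<close> the dilation by \<open>\<gamma>\<close> along \<open>x\<close>, the vectors \<open>w\<^sub>k = S\<^sup>-\<^sup>1 x\<^sub>k\<close> have norm tending to
  \<open>1 / \<gamma>\<close>, while \<open>f\<^sub>k(S\<^sup>-\<^sup>1 B S) w\<^sub>k = S\<^sup>-\<^sup>1 f\<^sub>k(B) x\<^sub>k\<close> tends to \<open>S\<^sup>-\<^sup>1 u = u\<close>.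
\<close>

lemma exists_worst_dilation:
  fixes B :: "complex ^ 'n ^ 'n"
  assumes "infinite K" "spectral_set M K B" "1 < M"
    and "\<forall>C. spectral_set C K B \<longrightarrow> M \<le> C" and \<gamma>: "1 \<le> \<gamma>"
  obtains S :: "complex ^ 'n ^ 'n" where "positive_matrix S" "invertible S"
    "condition_number S = \<gamma>"
    "\<forall>C. spectral_set C K (matrix_inv S ** B ** S) \<longrightarrow> \<gamma> * M \<le> C"
proof -
  obtain q p X x u where q: "\<forall>k. \<forall>z\<in>K. poly (q k) z \<noteq> 0"
    and p: "\<forall>k. \<forall>z\<in>K. cmod (poly (p k) z / poly (q k) z) \<le> 1"
    and X: "X \<longlonglongrightarrow> x" and U: "(\<lambda>k. rational_matrix (p k) (q k) B *v X k) \<longlonglongrightarrow> u"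
    and xu: "norm x = 1" "norm u = M" "hinner u x = 0"
    by (rule extremal_sequence[OF assms(1-4)])
  have K: "spectrum B \<subseteq> K" "K \<noteq> {}"
    using assms(1,2) by (auto simp: spectral_set_def)
  let ?S = "dilation x \<gamma>" and ?T = "dilation x (1 / \<gamma>)"
  have "u \<noteq> 0" "\<gamma> \<noteq> 0" using xu(2) assms(3) \<gamma> by auto
  note S = dilation_inverse[OF xu(1) \<open>\<gamma> \<noteq> 0\<close>]
  have lower: "\<forall>C. spectral_set C K (matrix_inv ?S ** B ** ?S) \<longrightarrow> \<gamma> * M \<le> C"
  proof (intro allI impI)
    fix C
    assume C: "spectral_set C K (matrix_inv ?S ** B ** ?S)"
    let ?F = "\<lambda>k. rational_matrix (p k) (q k) B"
    let ?G = "\<lambda>k. rational_matrix (p k) (q k) (matrix_inv ?S ** B ** ?S)"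
    \<comment> \<open>The inverse dilation intertwines \<open>f(B)\<close> with \<open>f\<close> of
      the conjugated matrix.\<close>
    have "?T *v (?F k *v X k) = ?G k *v (?T *v X k)" for k
    proof -
      have "q k \<noteq> 0"
        using q K(2) by (metis ex_in_conv poly_0)
      then have "invertible (poly_matrix (q k) B)"
        using q K(1) by (intro invertible_poly_matrix) auto
      then have "?G k = ?T ** ?F k ** ?S"
        using rational_matrix_similar[OF S(1)] S(2) by simp
      then have "?G k ** ?T = ?T ** ?F k ** (?S ** ?T)"
        by (simp only: matrix_mul_assoc)
      also have "\<dots> = ?T ** ?F k"
        using matrix_inv_right[OF S(1)] S(2) by simp
      finally show ?thesis by (simp add: matrix_vector_mul_assoc)
    qed
    moreover have "norm (?G k *v (?T *v X k)) \<le> C * norm (?T *v X k)" for k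
    proof -
      have "opnorm (?G k) \<le> C"
        using spectral_set_bound[OF C K(2) q[rule_format] p[rule_format], of k] by simp
      then show ?thesis
        using opnorm_bound[of "?G k"] mult_right_mono norm_ge_zero order_trans by blast
    qed
    ultimately have le: "norm (?T *v (?F k *v X k)) \<le> C * norm (?T *v X k)" for k
      by simp
    have "norm (?T *v u) \<le> C * norm (?T *v x)"
    proof (rule LIMSEQ_le)
      show "(\<lambda>k. norm (?T *v (?F k *v X k))) \<longlonglongrightarrow> norm (?T *v u)"
        by (intro tendsto_intros tendsto_matrix_vector_mult U)
      show "(\<lambda>k. C * norm (?T *v X k)) \<longlonglongrightarrow> C * norm (?T *v x)"
        by (intro tendsto_intros tendsto_matrix_vector_mult X)
    qed (use le in blast)
    \<comment> \<open>Orthogonality gives \<open>?T *v u = u\<close>, of norm \<open>M\<close>,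
      whereas \<open>?T\<close> shrinks \<open>x\<close> to length
      \<open>1 / \<gamma>\<close>.\<close>
    then have "M \<le> C * (1 / \<gamma>)"
      using \<gamma> xu by (simp add: dilation_fixes dilation_self norm_vector_smult norm_divide)
    then show "\<gamma> * M \<le> C"
      using \<gamma> by (simp add: field_simps)
  qed
  \<comment> \<open>The nonzero vector \<open>u\<close>, orthogonal to \<open>x\<close>, is the
    fixed vector required for the condition number.\<close>
  show thesis
    using that[OF positive_dilation[OF xu(1) \<gamma>] S(1)
        condition_number_dilation[OF xu(1) \<gamma> xu(3) \<open>u \<noteq> 0\<close>] lower] .
qed

section \<open>Combination of the upper and lower bounds\<close>

theorem theorem3p2:
  fixes A :: "complex ^ 'n ^ 'n" and D :: "complex set"
  assumes "CARD('n) \<ge> 2"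
    and "D \<noteq> {}" "open D" "connected D" "convex D" "bounded D"
    and "spectrum A \<subseteq> D"
    and "\<M> D A > 1"
  shows "(\<forall>\<gamma>\<ge>1. \<exists>S :: complex ^ 'n ^ 'n.
            positive_matrix S \<and> invertible S \<and> condition_number S = \<gamma> \<and>
            \<M> D (matrix_inv S ** A ** S) = \<gamma> * \<M> D A) \<and>
         (\<forall>\<gamma>\<ge>1.
            (\<exists>R :: complex ^ 'n ^ 'n. invertible R \<and> condition_number R \<le> \<gamma> \<and>
               \<M> D (matrix_inv R ** A ** R) = \<gamma> * \<M> D A) \<and>
            (\<forall>R :: complex ^ 'n ^ 'n. invertible R \<and> condition_number R \<le> \<gamma> \<longrightarrow>
               \<M> D (matrix_inv R ** A ** R) \<le> \<gamma> * \<M> D A))"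
proof -
  have ne: "closure D \<noteq> {}" using assms(2) by simp
  \<comment> \<open>Needed to extract normalized witnesses; a nonempty open subset of the plane is
    infinite.\<close>
  have "infinite (closure D)"
    using assms(2,3) closure_subset[of D] finite_imp_not_open finite_subset by metis
  have A: "spectral_set (\<M> D A) (closure D) A"
    using assms by (intro spectral_set_closure) auto
  have least: "\<forall>C. spectral_set C (closure D) A \<longrightarrow> \<M> D A \<le> C"
    unfolding spectral_constant_on_def using optimal_spectral_constant(2)[OF _ ne] by blast
  have upper: "\<M> D (matrix_inv R ** A ** R) \<le> \<gamma> * \<M> D A"
    if "1 \<le> \<gamma>" "invertible R" "condition_number R \<le> \<gamma>" for \<gamma> and R :: "complex ^ 'n ^ 'n"
    using optimal_spectral_constant(2)[OF spectral_set_similar[OF A ne that(2,3,1)] ne]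
    by (simp add: spectral_constant_on_def)
  have ex: "\<exists>S :: complex ^ 'n ^ 'n. positive_matrix S \<and> invertible S \<and> condition_number S = \<gamma> \<and>
      \<M> D (matrix_inv S ** A ** S) = \<gamma> * \<M> D A" if "1 \<le> \<gamma>" for \<gamma>
  proof -
    obtain S :: "complex ^ 'n ^ 'n" where S: "positive_matrix S" "invertible S"
      "condition_number S = \<gamma>"
      "\<forall>C. spectral_set C (closure D) (matrix_inv S ** A ** S) \<longrightarrow> \<gamma> * \<M> D A \<le> C"
      by (rule exists_worst_dilation[OF \<open>infinite (closure D)\<close> A assms(8) least \<open>1 \<le> \<gamma>\<close>])
    have "spectral_set (\<M> D (matrix_inv S ** A ** S)) (closure D) (matrix_inv S ** A ** S)"
      using assms spectrum_similar[OF S(2), of A] by (intro spectral_set_closure) auto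
    \<comment> \<open>The optimal constant is itself spectral, so the lower bound from
      \<open>S\<close> applies to it; the upper bound with \<open>R = S\<close> gives
      equality.\<close>
    then have "\<M> D (matrix_inv S ** A ** S) = \<gamma> * \<M> D A"
      using S(2-4) upper[OF that] by (intro antisym) simp_all
    with S(1-3) show ?thesis by blast
  qed
  show ?thesis
  proof (intro conjI allI impI)
    fix \<gamma> :: real
    assume "1 \<le> \<gamma>"
    from ex[OF this] show "\<exists>R :: complex ^ 'n ^ 'n. invertible R \<and> condition_number R \<le> \<gamma> \<and>
        \<M> D (matrix_inv R ** A ** R) = \<gamma> * \<M> D A"
      by auto
  qed (use ex upper in auto)
qed

end
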